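(* Let $\alpha\in(0,2]$, let $\xi$ be an $S\alpha S$ random vector in $\mathbb{R}^d$ with associated star body $F$, and let $\lambda\in(-d,\alpha)$. Then $$\mathbf{E}\|\xi\|^\lambda=\frac{2^{\lambda-1}}{\pi^{d/2}}\,\Gamma\Big(\frac{d+\lambda}{2}\Big)\,\frac{\Gamma(1-\frac{\lambda}{\alpha})}{\Gamma(1-\frac{\lambda}{2})}\int_{\mathbb{S}^{d-1}}\|u\|_F^\lambda\,du .$$
   Context: A random vector $\xi\in\mathbb{R}^d$ is symmetric $\alpha$-stable ($S\alpha S$), $\alpha\in(0,2]$, if $\xi$ has the same distribution as $-\xi$ and $a^{1/\alpha}\xi_1+b^{1/\alpha}\xi_2$ has the same distribution as $(a+b)^{1/\alpha}\xi$ for all $a,b>0$, where $\xi_1,\xi_2$ are independent copies of $\xi$. Its characteristic function can be written as $\mathbf{E}e^{i\langle\xi,u\rangle}=\exp\{-\int_{\mathbb{S}^{d-1}}|\langle u,z\rangle|^\alpha\sigma(dz)\}$ for a symmetric finite measure $\sigma$ on the Euclidean unit sphere $\mathbb{S}^{d-1}$ (the spectral measure). Put $\|u\|_F^\alpha=\int_{\mathbb{S}^{d-1}}|\langle u,z\rangle|^\alpha\sigma(dz)$, so that $\mathbf{E}e^{i\langle\xi,u\rangle}=e^{-\|u\|_F^\alpha}$; the set $F=\{u:\|u\|_F\le1\}$ is the associated star body of $\xi$ (and $\|\cdot\|_F$, which need not be convex, is its Minkowski functional). $\|\cdot\|$ without subscript is the Euclidean norm and $du$ is the (unnormalised) surface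 area measure on $\mathbb{S}^{d-1}$. Both sides are regarded as elements of $[0,\infty]$, with $0^\lambda=\infty$ for $\lambda<0$ and $0^0=1$. *)

theory Defs
  imports "HOL-Probability.Probability"
begin

text \<open>
  Independent copies \<open>\<xi>\<^sub>1, \<xi>\<^sub>2\<close> of \<open>\<xi>\<close> are realised as
  \<open>\<xi> \<circ> fst\<close> and \<open>\<xi> \<circ> snd\<close> on the product space;
  the law of a function of \<open>(\<xi>\<^sub>1, \<xi>\<^sub>2)\<close> does not depend on this choice.
\<close>

definition symmetric_stable :: "real \<Rightarrow> 'w measure \<Rightarrow> ('w \<Rightarrow> 'a::euclidean_space) \<Rightarrow> bool" where
  "symmetric_stable \<alpha> M \<xi> \<longleftrightarrow>
     distr M borel \<xi> = distr M borel (\<lambda>\<omega>. - \<xi> \<omega>) \<and>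
     (\<forall>a>0. \<forall>b>0.
        distr (M \<Otimes>\<^sub>M M) borel
          (\<lambda>\<omega>. a powr (1/\<alpha>) *\<^sub>R \<xi> (fst \<omega>) + b powr (1/\<alpha>) *\<^sub>R \<xi> (snd \<omega>)) =
        distr M borel (\<lambda>\<omega>. (a + b) powr (1/\<alpha>) *\<^sub>R \<xi> \<omega>))"

definition spectral_measure ::
    "real \<Rightarrow> 'w measure \<Rightarrow> ('w \<Rightarrow> 'a::euclidean_space) \<Rightarrow> 'a measure \<Rightarrow> bool" where
  "spectral_measure \<alpha> M \<xi> \<sigma> \<longleftrightarrow>
     finite_measure \<sigma> \<and>
     sets \<sigma> = sets (restrict_space borel (sphere 0 1)) \<and>
     distr \<sigma> \<sigma> uminus = \<sigma> \<and>
     (\<forall>u. (CLINT \<omega>|M. iexp (\<xi> \<omega> \<bullet> u)) =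
           complex_of_real (exp (- (LINT z|\<sigma>. \<bar>u \<bullet> z\<bar> powr \<alpha>))))"

definition star_norm :: "real \<Rightarrow> 'a::euclidean_space measure \<Rightarrow> 'a \<Rightarrow> real" where
  "star_norm \<alpha> \<sigma> u = (LINT z|\<sigma>. \<bar>u \<bullet> z\<bar> powr \<alpha>) powr (1/\<alpha>)"

definition star_body :: "real \<Rightarrow> 'a::euclidean_space measure \<Rightarrow> 'a set" where
  "star_body \<alpha> \<sigma> = {u. star_norm \<alpha> \<sigma> u \<le> 1}"

definition minkowski_functional :: "'a::real_vector set \<Rightarrow> 'a \<Rightarrow> real" where
  "minkowski_functional F u = Inf {t. 0 < t \<and> u \<in> (\<lambda>x. t *\<^sub>R x) ` F}"

lemma star_norm_scaleR:
  assumes "\<alpha> > 0" "t \<ge> 0"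
  shows "star_norm \<alpha> \<sigma> (t *\<^sub>R u) = t * star_norm \<alpha> \<sigma> u"
proof -
  have "(LINT z|\<sigma>. \<bar>(t *\<^sub>R u) \<bullet> z\<bar> powr \<alpha>) = (LINT z|\<sigma>. t powr \<alpha> * \<bar>u \<bullet> z\<bar> powr \<alpha>)"
    using assms by (intro Bochner_Integration.integral_cong) (auto simp: abs_mult powr_mult)
  also have "\<dots> = t powr \<alpha> * (LINT z|\<sigma>. \<bar>u \<bullet> z\<bar> powr \<alpha>)"
    by simp
  finally show ?thesis
    using assms by (simp add: star_norm_def powr_mult powr_powr)
qed

lemma minkowski_functional_star_body:
  assumes "\<alpha> > 0"
  shows "minkowski_functional (star_body \<alpha> \<sigma>) u = star_norm \<alpha> \<sigma> u"
proof -
  let ?N = "star_norm \<alpha> \<sigma>"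
  have mem: "u \<in> (\<lambda>x. t *\<^sub>R x) ` star_body \<alpha> \<sigma> \<longleftrightarrow> ?N u \<le> t" if t: "t > 0" for t
  proof
    assume "u \<in> (\<lambda>x. t *\<^sub>R x) ` star_body \<alpha> \<sigma>"
    then obtain x where "u = t *\<^sub>R x" "?N x \<le> 1"
      by (auto simp: star_body_def)
    then show "?N u \<le> t"
      using assms t by (simp add: star_norm_scaleR)
  next
    assume "?N u \<le> t"
    then have "?N ((1/t) *\<^sub>R u) \<le> 1"
      using assms t by (subst star_norm_scaleR) (auto simp: field_simps)
    moreover have "u = t *\<^sub>R ((1/t) *\<^sub>R u)"
      using t by simp
    ultimately show "u \<in> (\<lambda>x. t *\<^sub>R x) ` star_body \<alpha> \<sigma>"
      unfolding star_body_def by blast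
  qed
  have nonneg: "?N u \<ge> 0"
    by (simp add: star_norm_def)
  have "{t. 0 < t \<and> u \<in> (\<lambda>x. t *\<^sub>R x) ` star_body \<alpha> \<sigma>} = {t. 0 < t \<and> ?N u \<le> t}"
    using mem by blast
  also have "Inf \<dots> = ?N u"
  proof (cases "?N u = 0")
    case True
    then have "{t. 0 < t \<and> ?N u \<le> t} = {0<..}" by auto
    then show ?thesis using True by simp
  next
    case False
    then have "{t. 0 < t \<and> ?N u \<le> t} = {?N u..}" using nonneg by auto
    then show ?thesis by simp
  qed
  finally show ?thesis by (simp add: minkowski_functional_def)
qed

text \<open>
  Surface area measure on the unit sphere, as cone measure: the area of \<open>A\<close> is
  \<open>d\<close> times the volume of the cone \<open>{t *\<^sub>R u | u t. u \<in> A \<and> 0 < t \<and> t \<le> 1}\<close>,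
  and \<open>sgn x = x /\<^sub>R norm x\<close> is the radial projection.
  For \<open>d = 1\<close> this is the counting measure on \<open>{-1, 1}\<close>.
\<close>

definition surface_measure :: "'a::euclidean_space measure" where
  "surface_measure =
     scale_measure (ennreal (real DIM('a)))
       (distr (restrict_space lborel (cball 0 1 - {0})) (restrict_space borel (sphere 0 1)) sgn)"

lemma sgn_measurable_sphere:
  "(sgn :: 'a::euclidean_space \<Rightarrow> 'a)
     \<in> restrict_space lborel (cball 0 1 - {0}) \<rightarrow>\<^sub>M restrict_space borel (sphere 0 1)"
proof (rule measurable_restrict_space2)
  show "(sgn :: 'a \<Rightarrow> 'a)
      \<in> space (restrict_space lborel (cball 0 1 - {0})) \<rightarrow> sphere 0 1"
    by (auto simp: space_restrict_space norm_sgn)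
  show "(sgn :: 'a \<Rightarrow> 'a) \<in> restrict_space lborel (cball 0 1 - {0}) \<rightarrow>\<^sub>M borel"
    by (rule measurable_restrict_space1) measurable
qed

lemma emeasure_surface_measure:
  fixes A :: "'a::euclidean_space set"
  assumes "A \<in> sets borel" "A \<subseteq> sphere 0 1"
  shows "emeasure surface_measure A =
           ennreal (real DIM('a)) * emeasure lborel {x \<in> cball 0 1 - {0}. sgn x \<in> A}"
proof -
  have A: "A \<in> sets (restrict_space borel (sphere 0 1))"
    using assms by (subst sets_restrict_space_iff) auto
  have eq: "sgn -` A \<inter> space (restrict_space lborel (cball 0 1 - {0::'a})) =
        {x \<in> cball 0 1 - {0}. sgn x \<in> A}"
    by (auto simp: space_restrict_space)
  show ?thesis
    unfolding surface_measure_def emeasure_scale_measure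
    by (subst emeasure_distr[OF sgn_measurable_sphere A], subst eq,
        subst emeasure_restrict_space) auto
qed

lemma emeasure_surface_measure_sphere:
  "emeasure surface_measure (sphere (0::'a::euclidean_space) 1) =
     ennreal (real DIM('a) * unit_ball_vol (real DIM('a)))"
proof -
  have "{x \<in> cball (0::'a) 1 - {0}. sgn x \<in> sphere 0 1} = cball 0 1 - {0}"
    by (auto simp: norm_sgn)
  moreover have "emeasure lborel (cball (0::'a) 1 - {0}) = emeasure lborel (cball (0::'a) 1)"
    by (subst emeasure_Diff) auto
  ultimately show ?thesis
    by (subst emeasure_surface_measure) (auto simp: emeasure_cball ennreal_mult)
qed

text \<open>
  The power \<open>x\<^sup>p \<in> [0, \<infinity>]\<close> of \<open>x \<ge> 0\<close>; unlike
  \<^const>\<open>powr\<close>, it has \<open>0\<^sup>p = \<infinity>\<close> for \<open>p < 0\<close>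
  and \<open>0\<^sup>0 = 1\<close>.
\<close>

definition epowr :: "real \<Rightarrow> real \<Rightarrow> ennreal" where
  "epowr x p =
     (if x = 0 then (if p < 0 then \<infinity> else if p = 0 then 1 else 0) else ennreal (x powr p))"

end

theory Submission
  imports Defs
begin

text \<open>
  The formula compares \<open>\<xi>\<close> with a standard Gaussian vector \<open>N\<close> in the same space, independent of
  \<open>\<xi>\<close>. Conditioning \<open>E exp (i \<langle>\<xi>, N\<rangle> / s)\<close> on either vector gives, for every \<open>s > 0\<close>,
  \<open>E exp (- (norm \<xi>)\<^sup>2 / (2 s\<^sup>2)) = E exp (- (star_norm N / s)\<^sup>\<alpha>)\<close>
  (\<open>exponential_transform_duality\<close>); here the spectral representation of
  the characteristic function enters.

  Let \<open>V\<close> be a standard exponential variable independent of everything else. Since \<open>P (V > v) = exp (- v)\<close>,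
  the two sides are the probabilities that \<open>norm \<xi> / sqrt (2 V)\<close> and that \<open>star_norm N / V\<^bsup>1/\<alpha>\<^esup>\<close> are
  smaller than \<open>s\<close>. So these two quotients have the same law, and hence the same moment of order \<open>p\<close>
  in \<open>[0, \<infinity>]\<close>. The moments of \<open>V\<close> are values of the Gamma function, which gives
  \<open>E (norm \<xi>)\<^sup>p * 2\<^bsup>-p/2\<^esup> * Gamma (1 - p/2) = E (star_norm N)\<^sup>p * Gamma (1 - p/\<alpha>)\<close>
  (\<open>moments_from_exponential_transforms\<close>). Comparing laws first treats positive, zero and
  negative \<open>p\<close> alike, whether the moments are finite or not.

  It remains to write \<open>E (star_norm N)\<^sup>p\<close> as a spherical integral. The star norm is homogeneous and the
  Gaussian density is radial, so polar coordinates (\<open>nn_integral_polar\<close>) split off a one-dimensional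
  integral, again a value of the Gamma function (\<open>std_gaussian_moment_homogeneous\<close>).
\<close>


section \<open>Powers with values in the extended half-line\<close>

lemma borel_measurable_epowr [measurable]: "(\<lambda>x. epowr x p) \<in> borel_measurable borel"
  unfolding epowr_def by measurable

text \<open>
  The factor \<open>y\<close> has to be positive: for \<open>p < 0\<close> the rule fails at \<open>y = 0\<close>, where
  \<open>y powr p = 0\<close> but \<open>epowr 0 p = \<infinity>\<close>.
\<close>

lemma epowr_mult:
  assumes "x \<ge> 0" "y > 0"
  shows "epowr (x * y) p = epowr x p * ennreal (y powr p)"
  using assms by (auto simp: epowr_def powr_mult ennreal_mult ennreal_top_mult)

lemma epowr_divide:
  assumes "x \<ge> 0" "y > 0"
  shows "epowr (x / y) p = epowr x p * ennreal (y powr (- p))"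
  using epowr_mult[of x "1 / y" p] assms by (simp add: powr_divide powr_minus_divide)

section \<open>The standard exponential distribution\<close>

definition std_exponential :: "real measure" where
  "std_exponential = density lborel (exponential_density 1)"

lemma prob_space_std_exponential: "prob_space std_exponential"
  unfolding std_exponential_def by (rule prob_space_exponential_density) simp

lemma sets_std_exponential [measurable_cong, simp]: "sets std_exponential = sets borel"
  by (simp add: std_exponential_def)

lemma space_std_exponential [simp]: "space std_exponential = UNIV"
  by (simp add: std_exponential_def)

lemma emeasure_std_exponential_greaterThan:
  assumes "a \<ge> 0"
  shows "emeasure std_exponential {a<..} = ennreal (exp (- a))"
proof -
  interpret prob_space std_exponential by (rule prob_space_std_exponential)
  have "distributed std_exponential lborel (\<lambda>x. x) (exponential_density 1)"
    by (auto simp: distributed_def std_exponential_def distr_id2)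
  from exponential_distributedD_gt[OF this assms]
  have "measure std_exponential {a<..} = exp (- a)"
    by (simp add: greaterThan_def)
  thus ?thesis by (simp add: emeasure_eq_measure)
qed

lemma AE_std_exponential_pos: "AE v in std_exponential. v > 0"
proof -
  have "AE v in lborel. v \<noteq> (0::real)" by (rule AE_lborel_singleton)
  thus ?thesis unfolding std_exponential_def
    by (subst AE_density) (auto simp: exponential_density_def)
qed

lemma nn_integral_std_exponential_powr:
  assumes "q > -1"
  shows "(\<integral>\<^sup>+v. ennreal (v powr q) \<partial>std_exponential) = ennreal (Gamma (q + 1))"
proof -
  have "(\<integral>\<^sup>+v. ennreal (v powr q) \<partial>std_exponential) =
        (\<integral>\<^sup>+v. ennreal (indicator {0..} v * v powr ((q + 1) - 1) / exp v) \<partial>lborel)"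
    unfolding std_exponential_def
    by (subst nn_integral_density)
       (auto intro!: nn_integral_cong simp: exponential_density_def ennreal_mult'[symmetric]
          exp_minus field_simps split: split_indicator)
  also have "\<dots> = ennreal (Gamma (q + 1))"
    using assms by (subst Gamma_conv_nn_integral_real) auto
  finally show ?thesis .
qed

section \<open>Quotients by powers of an exponential variable\<close>

text \<open>
  Turns the distribution function of a quotient \<open>f / V\<^bsup>1/a\<^esup>\<close> into the tail of \<open>V\<close>.
\<close>

lemma quotient_lt_iff:
  assumes "f \<ge> 0" "s > 0" "a > 0" "v > (0::real)"
  shows "f / v powr (1 / a) < s \<longleftrightarrow> (f / s) powr a < v"
proof -
  have "f / v powr (1 / a) < s \<longleftrightarrow> f / s < v powr (1 / a)"
    using assms by (simp add: field_simps)
  also have "\<dots> \<longleftrightarrow> (f / s) powr a < (v powr (1 / a)) powr a"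
    using assms powr_less_mono2[of a "f / s" "v powr (1 / a)"]
      powr_mono2[of a "v powr (1 / a)" "f / s"]
    by (meson divide_nonneg_pos less_imp_le not_le powr_ge_zero)
  finally show ?thesis using assms by (simp add: powr_powr)
qed

text \<open>
  For fixed \<open>x\<close>, the event says that \<open>V\<close> exceeds \<open>(f x / s)\<^sup>a\<close>, which has probability
  \<open>exp (- (f x / s)\<^sup>a)\<close>. Thus, when \<open>M\<close> is a probability measure, the exponential transform of \<open>f\<close> on
  the right is the distribution function of the quotient.
\<close>

lemma emeasure_exponential_quotient_lt:
  assumes "sigma_finite_measure M" and [measurable]: "f \<in> borel_measurable M"
    and "\<And>x. f x \<ge> 0" and "a > 0" "s > 0"
  shows "emeasure (M \<Otimes>\<^sub>M std_exponential)
           {z \<in> space (M \<Otimes>\<^sub>M std_exponential). f (fst z) / snd z powr (1 / a) < s} =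
         (\<integral>\<^sup>+x. ennreal (exp (- ((f x / s) powr a))) \<partial>M)"
proof -
  interpret E: prob_space std_exponential by (rule prob_space_std_exponential)
  interpret M: sigma_finite_measure M by fact
  let ?A = "{z \<in> space (M \<Otimes>\<^sub>M std_exponential). f (fst z) / snd z powr (1 / a) < s}"
  have "emeasure (M \<Otimes>\<^sub>M std_exponential) ?A =
      (\<integral>\<^sup>+x. emeasure std_exponential (Pair x -` ?A) \<partial>M)"
    by (rule E.emeasure_pair_measure_alt) measurable
  also have "\<dots> = (\<integral>\<^sup>+x. ennreal (exp (- ((f x / s) powr a))) \<partial>M)"
  proof (rule nn_integral_cong)
    fix x assume x: "x \<in> space M"
    have "emeasure std_exponential (Pair x -` ?A) = emeasure std_exponential {(f x / s) powr a<..}"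
    proof (rule emeasure_eq_AE)
      show "AE v in std_exponential. v \<in> Pair x -` ?A \<longleftrightarrow> v \<in> {(f x / s) powr a<..}"
        using AE_std_exponential_pos
        by eventually_elim (use x assms in \<open>auto simp: space_pair_measure quotient_lt_iff\<close>)
      show "Pair x -` ?A \<in> sets std_exponential"
        by (rule sets_Pair1) measurable
    qed auto
    thus "emeasure std_exponential (Pair x -` ?A) = ennreal (exp (- ((f x / s) powr a)))"
      by (simp add: emeasure_std_exponential_greaterThan)
  qed
  finally show ?thesis .
qed

text \<open>
  By independence the moment factorises, and the factor \<open>E V\<^bsup>-p/a\<^esup> = Gamma (1 - p/a)\<close> is finite
  exactly because \<open>p < a\<close>.
\<close>

lemma nn_integral_exponential_quotient_powr:
  assumes "prob_space M" and [measurable]: "f \<in> borel_measurable M"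
    and "\<And>x. f x \<ge> 0" and "a > 0" "p < a"
  shows "(\<integral>\<^sup>+z. epowr (f (fst z) / snd z powr (1 / a)) p \<partial>(M \<Otimes>\<^sub>M std_exponential)) =
         (\<integral>\<^sup>+x. epowr (f x) p \<partial>M) * ennreal (Gamma (1 - p / a))"
proof -
  interpret E: prob_space std_exponential by (rule prob_space_std_exponential)
  have "(\<integral>\<^sup>+z. epowr (f (fst z) / snd z powr (1 / a)) p \<partial>(M \<Otimes>\<^sub>M std_exponential)) =
     (\<integral>\<^sup>+x. (\<integral>\<^sup>+v. epowr (f x / v powr (1 / a)) p \<partial>std_exponential) \<partial>M)"
    by (subst E.nn_integral_fst[symmetric]) auto
  also have "\<dots> = (\<integral>\<^sup>+x. epowr (f x) p * ennreal (Gamma (1 - p / a)) \<partial>M)"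
  proof (rule nn_integral_cong)
    fix x
    have "(\<integral>\<^sup>+v. epowr (f x / v powr (1 / a)) p \<partial>std_exponential) =
        (\<integral>\<^sup>+v. epowr (f x) p * ennreal (v powr (- p / a)) \<partial>std_exponential)"
      using AE_std_exponential_pos
      by (intro nn_integral_cong_AE, eventually_elim)
         (use assms in \<open>simp add: epowr_divide powr_powr\<close>)
    also have "\<dots> = epowr (f x) p * ennreal (Gamma (1 - p / a))"
      using assms nn_integral_std_exponential_powr[of "- p / a"]
      by (subst nn_integral_cmult) (auto simp: field_simps)
    finally show "(\<integral>\<^sup>+v. epowr (f x / v powr (1 / a)) p \<partial>std_exponential) =
      epowr (f x) p * ennreal (Gamma (1 - p / a))" .
  qed
  also have "\<dots> = (\<integral>\<^sup>+x. epowr (f x) p \<partial>M) * ennreal (Gamma (1 - p / a))"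
    by (rule nn_integral_multc) auto
  finally show ?thesis .
qed

text \<open>
  The assumed equality of transforms says that \<open>f / V\<^bsup>1/a\<^esup>\<close> and \<open>g / V\<^bsup>1/b\<^esup>\<close> have the same
  distribution function, hence the same law and the same moments.
\<close>

lemma moments_from_exponential_transforms:
  assumes M: "prob_space M" and f [measurable]: "f \<in> borel_measurable M" and f0: "\<And>x. f x \<ge> 0"
    and N: "prob_space N" and g [measurable]: "g \<in> borel_measurable N" and g0: "\<And>y. g y \<ge> 0"
    and a: "a > 0" "p < a" and b: "b > 0" "p < b"
    and eq: "\<And>s. s > 0 \<Longrightarrow> (\<integral>\<^sup>+x. ennreal (exp (- ((f x / s) powr a))) \<partial>M) =
                         (\<integral>\<^sup>+y. ennreal (exp (- ((g y / s) powr b))) \<partial>N)"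
  shows "(\<integral>\<^sup>+x. epowr (f x) p \<partial>M) * ennreal (Gamma (1 - p / a)) =
         (\<integral>\<^sup>+y. epowr (g y) p \<partial>N) * ennreal (Gamma (1 - p / b))"
proof -
  interpret M: prob_space M by fact
  interpret N: prob_space N by fact
  interpret E: prob_space std_exponential by (rule prob_space_std_exponential)
  interpret ME: pair_prob_space M std_exponential ..
  interpret NE: pair_prob_space N std_exponential ..
  \<comment> \<open>The transforms give the probabilities of \<open>{..<s}\<close> for \<open>s > 0\<close>, whereas \<open>measure_eqI_lessThan\<close>
      asks for upper rays; hence the change of sign.\<close>
  define X where "X = (\<lambda>z. - (f (fst z) / snd z powr (1 / a)))"
  define Y where "Y = (\<lambda>z. - (g (fst z) / snd z powr (1 / b)))"
  have [measurable]: "X \<in> borel_measurable (M \<Otimes>\<^sub>M std_exponential)"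
      "Y \<in> borel_measurable (N \<Otimes>\<^sub>M std_exponential)"
    unfolding X_def Y_def by measurable
  have "distr (M \<Otimes>\<^sub>M std_exponential) borel X = distr (N \<Otimes>\<^sub>M std_exponential) borel Y"
  proof (rule measure_eqI_lessThan)
    fix s :: real
    show "emeasure (distr (M \<Otimes>\<^sub>M std_exponential) borel X) {s<..} < \<infinity>"
      by (simp add: emeasure_distr less_top[symmetric])
    show "emeasure (distr (M \<Otimes>\<^sub>M std_exponential) borel X) {s<..} =
          emeasure (distr (N \<Otimes>\<^sub>M std_exponential) borel Y) {s<..}"
    proof (cases "s < 0")
      case True
      have "X -` {s<..} \<inter> space (M \<Otimes>\<^sub>M std_exponential) =
         {z \<in> space (M \<Otimes>\<^sub>M std_exponential). f (fst z) / snd z powr (1 / a) < - s}"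
        "Y -` {s<..} \<inter> space (N \<Otimes>\<^sub>M std_exponential) =
         {z \<in> space (N \<Otimes>\<^sub>M std_exponential). g (fst z) / snd z powr (1 / b) < - s}"
        by (auto simp: X_def Y_def)
      with True show ?thesis
        using emeasure_exponential_quotient_lt[OF M.sigma_finite_measure_axioms f f0 a(1), of "- s"]
          emeasure_exponential_quotient_lt[OF N.sigma_finite_measure_axioms g g0 b(1), of "- s"]
          eq[of "- s"]
        by (simp add: emeasure_distr)
    next
      case False
      have "X z \<le> 0" "Y z' \<le> 0" for z z'
        using f0 g0 by (auto simp: X_def Y_def)
      hence "X -` {s<..} = {}" "Y -` {s<..} = {}"
        using False by (auto simp: not_less) (meson le_less_trans less_le_not_le)+
      thus ?thesis by (simp add: emeasure_distr)
    qed
  qed auto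
  hence "(\<integral>\<^sup>+t. epowr (- t) p \<partial>distr (M \<Otimes>\<^sub>M std_exponential) borel X) =
        (\<integral>\<^sup>+t. epowr (- t) p \<partial>distr (N \<Otimes>\<^sub>M std_exponential) borel Y)"
    by simp
  hence "(\<integral>\<^sup>+z. epowr (- X z) p \<partial>(M \<Otimes>\<^sub>M std_exponential)) =
        (\<integral>\<^sup>+z. epowr (- Y z) p \<partial>(N \<Otimes>\<^sub>M std_exponential))"
    by (simp add: nn_integral_distr)
  thus ?thesis
    using nn_integral_exponential_quotient_powr[OF M f f0 a]
      nn_integral_exponential_quotient_powr[OF N g g0 b]
    by (simp add: X_def Y_def)
qed

section \<open>The standard Gaussian vector\<close>

lemma norm_squared_Basis: "(norm (x :: 'a::euclidean_space))\<^sup>2 = (\<Sum>b\<in>Basis. (x \<bullet> b)\<^sup>2)"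
  by (subst power2_norm_eq_inner, subst euclidean_inner) (simp only: power2_eq_square)

text \<open>
  The density is kept as a product over the coordinates, so that the total mass and the characteristic
  function reduce to dimension one.
\<close>

definition std_gaussian :: "'a::euclidean_space measure" where
  "std_gaussian = density lborel (\<lambda>x. \<Prod>b\<in>Basis. std_normal_density (x \<bullet> b))"

lemma sets_std_gaussian [measurable_cong, simp]: "sets std_gaussian = sets borel"
  by (simp add: std_gaussian_def)

lemma space_std_gaussian [simp]: "space std_gaussian = UNIV"
  by (simp add: std_gaussian_def)

lemma std_gaussian_density:
  fixes x :: "'a::euclidean_space"
  shows "(\<Prod>b\<in>Basis. std_normal_density (x \<bullet> b)) =
    (2 * pi) powr (- (real DIM('a) / 2)) * exp (- (norm x)\<^sup>2 / 2)"
proof -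
  have "(\<Prod>b\<in>Basis. std_normal_density (x \<bullet> b)) =
      (1 / sqrt (2 * pi)) ^ DIM('a) * exp (\<Sum>b\<in>Basis. - (x \<bullet> b)\<^sup>2 / 2)"
    unfolding std_normal_density_def prod.distrib by (simp add: exp_sum)
  also have "(\<Sum>b\<in>Basis. - (x \<bullet> b)\<^sup>2 / 2) = - (norm x)\<^sup>2 / 2"
    by (simp add: norm_squared_Basis sum_negf flip: sum_divide_distrib)
  also have "(1 / sqrt (2 * pi)) ^ DIM('a) = (2 * pi) powr (- (real DIM('a) / 2))"
  proof -
    have "(1 / sqrt (2 * pi)) ^ DIM('a) = ((2 * pi) powr (- (1 / 2))) powr real DIM('a)"
      by (subst powr_realpow) (auto simp: powr_minus_divide powr_half_sqrt)
    also have "\<dots> = (2 * pi) powr (- (1 / 2) * real DIM('a))"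
      by (rule powr_powr)
    finally show ?thesis by simp
  qed
  finally show ?thesis .
qed

lemma prob_space_std_gaussian: "prob_space (std_gaussian :: 'a::euclidean_space measure)"
proof
  have "emeasure (std_gaussian :: 'a measure) UNIV =
      (\<integral>\<^sup>+x. (\<Prod>b\<in>(Basis :: 'a set). ennreal (std_normal_density (x \<bullet> b))) \<partial>lborel)"
    unfolding std_gaussian_def
    by (subst emeasure_density) (auto simp: prod_ennreal)
  also have "\<dots> = (\<Prod>b\<in>(Basis :: 'a set). \<integral>\<^sup>+x. ennreal (std_normal_density x) \<partial>lborel)"
    by (rule nn_integral_lborel_prod) auto
  also have "(\<integral>\<^sup>+x. ennreal (std_normal_density x) \<partial>lborel) = 1"
    using prob_space.emeasure_space_1[OF prob_space_normal_density[of 1 0]]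
    by (simp add: emeasure_density)
  finally show "emeasure (std_gaussian :: 'a measure) (space std_gaussian) = 1" by simp
qed

lemma char_std_gaussian:
  fixes y :: "'a::euclidean_space"
  shows "(CLINT x|std_gaussian. iexp (y \<bullet> x)) = complex_of_real (exp (- (norm y)\<^sup>2 / 2))"
proof -
  interpret product_sigma_finite "\<lambda>_::'a. lborel :: real measure" ..
  let ?g = "\<lambda>b t. std_normal_density t *\<^sub>R iexp ((y \<bullet> b) * t)"
  have inner: "y \<bullet> x = (\<Sum>b\<in>Basis. (y \<bullet> b) * (x \<bullet> b))" for x
    by (rule euclidean_inner)
  have "(CLINT x|std_gaussian. iexp (y \<bullet> x)) =
      (CLINT x|lborel. (\<Prod>b\<in>Basis. std_normal_density (x \<bullet> b)) *\<^sub>R iexp (y \<bullet> x))"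
    unfolding std_gaussian_def
    by (rule integral_density) (auto intro!: prod_nonneg)
  also have "\<dots> = (CLINT x|lborel. (\<Prod>b\<in>Basis. ?g b (x \<bullet> b)))"
  proof (rule Bochner_Integration.integral_cong)
    fix x :: 'a
    have "iexp (y \<bullet> x) = (\<Prod>b\<in>Basis. iexp ((y \<bullet> b) * (x \<bullet> b)))"
      by (subst inner) (simp add: exp_sum sum_distrib_left)
    thus "(\<Prod>b\<in>Basis. std_normal_density (x \<bullet> b)) *\<^sub>R iexp (y \<bullet> x) =
        (\<Prod>b\<in>Basis. ?g b (x \<bullet> b))"
      by (simp add: scaleR_conv_of_real prod.distrib)
  qed simp
  also have "\<dots> = (CLINT f|(\<Pi>\<^sub>M b\<in>(Basis::'a set). lborel). (\<Prod>b\<in>Basis. ?g b (f b)))"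
    by (subst lborel_eq, subst integral_distr) (auto intro!: Bochner_Integration.integral_cong)
  also have "\<dots> = (\<Prod>b\<in>Basis. CLINT t|lborel. ?g b t)"
  proof (rule product_integral_prod)
    fix b :: 'a
    have "integrable std_normal_distribution (\<lambda>t. iexp ((y \<bullet> b) * t))"
      using prob_space.integrable_iexp[OF prob_space_normal_density[of 1 0],
          of "\<lambda>t. complex_of_real ((y \<bullet> b) * t)"] by simp
    thus "integrable lborel (?g b)"
      by (subst (asm) integrable_density) auto
  qed auto
  also have "\<dots> = (\<Prod>b\<in>Basis. complex_of_real (exp (- ((y \<bullet> b)\<^sup>2) / 2)))"
  proof (rule prod.cong)
    fix b :: 'a
    have "(CLINT t|lborel. ?g b t) = char std_normal_distribution (y \<bullet> b)"
      unfolding char_def by (subst integral_density) auto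
    thus "(CLINT t|lborel. ?g b t) = complex_of_real (exp (- ((y \<bullet> b)\<^sup>2) / 2))"
      by (simp add: char_std_normal_distribution)
  qed auto
  also have "\<dots> = complex_of_real (exp (\<Sum>b\<in>Basis. - ((y \<bullet> b)\<^sup>2) / 2))"
    by (simp add: exp_sum del: of_real_exp)
  also have "(\<Sum>b\<in>Basis. - ((y \<bullet> b)\<^sup>2) / 2) = - (norm y)\<^sup>2 / 2"
    by (simp add: norm_squared_Basis sum_negf flip: sum_divide_distrib)
  finally show ?thesis .
qed

text \<open>
  Both sides equal \<open>E exp (i \<langle>\<xi>, N\<rangle>)\<close> for a Gaussian vector \<open>N\<close> independent of \<open>\<xi>\<close>: on the left the
  integration over \<open>N\<close> has been carried out, on the right it is the outer one.
\<close>

lemma char_duality: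
  fixes \<xi> :: "'w \<Rightarrow> 'a::euclidean_space"
  assumes "prob_space M" and [measurable]: "\<xi> \<in> borel_measurable M"
  shows "(CLINT \<omega>|M. complex_of_real (exp (- (norm (\<xi> \<omega>))\<^sup>2 / 2))) =
         (CLINT x|std_gaussian. CLINT \<omega>|M. iexp (\<xi> \<omega> \<bullet> x))"
proof -
  interpret M: prob_space M by fact
  interpret N: prob_space "std_gaussian :: 'a measure" by (rule prob_space_std_gaussian)
  interpret pair_prob_space M "std_gaussian :: 'a measure" ..
  have "integrable (M \<Otimes>\<^sub>M (std_gaussian :: 'a measure)) (\<lambda>(\<omega>, x). iexp (\<xi> \<omega> \<bullet> x))"
    unfolding case_prod_beta
    by (rule P.integrable_iexp) auto
  from Fubini_integral[OF this] show ?thesis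
    by (simp add: char_std_gaussian)
qed

section \<open>Polar coordinates\<close>

lemma nn_integral_lborel_scaleR:
  fixes f :: "'a::euclidean_space \<Rightarrow> ennreal"
  assumes [measurable]: "f \<in> borel_measurable borel" and "c > 0"
  shows "(\<integral>\<^sup>+x. f x \<partial>lborel) = ennreal (c ^ DIM('a)) * (\<integral>\<^sup>+x. f (c *\<^sub>R x) \<partial>lborel)"
  using assms(2)
  by (subst lborel_affine[of c 0])
     (simp_all add: nn_integral_density nn_integral_distr nn_integral_cmult)

lemma nn_integral_surface_measure:
  fixes F :: "'a::euclidean_space \<Rightarrow> ennreal"
  assumes [measurable]: "F \<in> borel_measurable borel"
  shows "(\<integral>\<^sup>+u. F u \<partial>surface_measure) =
    ennreal (real DIM('a)) * (\<integral>\<^sup>+x. F (sgn x) * indicator (cball 0 1 - {0}) x \<partial>lborel)"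
proof -
  let ?S = "restrict_space borel (sphere (0::'a) 1)"
  have F: "F \<in> borel_measurable ?S"
    by (rule measurable_restrict_space1) measurable
  hence "(\<integral>\<^sup>+u. F u \<partial>surface_measure) = ennreal (real DIM('a)) *
      (\<integral>\<^sup>+x. F (sgn x) \<partial>restrict_space lborel (cball 0 1 - {0}))"
    unfolding surface_measure_def
    by (simp add: nn_integral_scale_measure nn_integral_distr[OF sgn_measurable_sphere])
  thus ?thesis
    by (simp add: nn_integral_restrict_space)
qed

lemma sgn_scaleR_pos: "c > 0 \<Longrightarrow> sgn (c *\<^sub>R x) = sgn (x :: 'a::real_normed_vector)"
  by (simp add: sgn_scaleR)

text \<open>
  Both factors of the right-hand side are combined by scaling and Tonelli alone. Write \<open>d\<close> for the
  dimension and \<open>|x|\<close> for the norm. The spherical integral is \<open>d\<close> times the integral \<open>B\<close> of \<open>F (sgn x)\<close>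
  over the unit ball, and \<open>r\<^sup>d * B\<close> is the same integral over the ball of radius \<open>r\<close>. Hence
  \<open>(\<integral> h(r) r\<^bsup>d-1\<^esup> dr) * B\<close> is the integral of \<open>F (sgn x) * h(r) / r\<close> over all pairs with \<open>|x| \<le> r\<close>.
  The substitution \<open>r = t |x|\<close> with \<open>t \<ge> 1\<close>, followed by the rescaling of \<open>x\<close> by \<open>t\<close>, turns this into
  \<open>\<integral>\<^sub>1\<^sup>\<infinity> t\<^bsup>-d-1\<^esup> dt = 1/d\<close> times the left-hand side.
\<close>

lemma nn_integral_polar:
  fixes F :: "'a::euclidean_space \<Rightarrow> ennreal" and h :: "real \<Rightarrow> ennreal"
  assumes [measurable]: "F \<in> borel_measurable borel" "h \<in> borel_measurable borel"
  shows "(\<integral>\<^sup>+x. h (norm x) * F (sgn x) \<partial>lborel) =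
    (\<integral>\<^sup>+r. h r * ennreal (r powr (real DIM('a) - 1)) * indicator {0<..} r \<partial>lborel) *
    (\<integral>\<^sup>+u. F u \<partial>surface_measure)"
proof -
  let ?d = "real DIM('a)"
  define B where "B = (\<integral>\<^sup>+x. F (sgn x) * indicator (cball 0 1 - {0}) x \<partial>lborel)"
  \<comment> \<open>The origin is removed because \<open>r = t |x|\<close> is not a substitution there.\<close>
  define G where "G = (\<lambda>x. h (norm x) * F (sgn x) * indicator (- {0}) x)"
  define I where "I = (\<integral>\<^sup>+x. h (norm x) * F (sgn x) \<partial>lborel)"
  have [measurable]: "G \<in> borel_measurable borel" unfolding G_def by measurable
  have [measurable]: "cball (0::'a) r - {0} \<in> sets borel" for r
    by (intro sets.Diff) auto
  have pos: "norm x \<le> r \<Longrightarrow> x \<noteq> 0 \<Longrightarrow> r > 0" for x :: 'a and r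
    using zero_less_norm_iff[of x] by linarith
  have IG: "I = (\<integral>\<^sup>+x. G x \<partial>lborel)"
    unfolding I_def G_def
    using AE_lborel_singleton[of "0::'a"]
    by (intro nn_integral_cong_AE, eventually_elim) simp
  \<comment> \<open>scaling of the unit ball to radius \<open>r\<close>\<close>
  have ball: "ennreal (r powr (?d - 1)) * B =
      ennreal (1 / r) * (\<integral>\<^sup>+x. F (sgn x) * indicator (cball 0 r - {0}) x \<partial>lborel)" if "r > 0" for r
  proof -
    have "(\<integral>\<^sup>+x. F (sgn x) * indicator (cball 0 r - {0}) x \<partial>lborel) = ennreal (r ^ DIM('a)) * B"
      unfolding B_def using that
      by (subst nn_integral_lborel_scaleR[of _ r])
         (auto intro!: arg_cong2[where f="(*)"] nn_integral_cong simp: sgn_scaleR_pos split: split_indicator)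
    moreover have "ennreal (r powr (?d - 1)) = ennreal (1 / r) * ennreal (r ^ DIM('a))"
      using that by (simp add: powr_diff powr_realpow flip: ennreal_mult)
    ultimately show ?thesis
      by (simp add: mult.assoc)
  qed
  \<comment> \<open>the substitution \<open>r = t |x|\<close>, under which \<open>dr / r\<close> is invariant\<close>
  have radial: "(\<integral>\<^sup>+r. h r * ennreal (1 / r) * indicator {norm x..} r \<partial>lborel) =
      (\<integral>\<^sup>+t. h (t * norm x) * ennreal (1 / t) * indicator {1..} t \<partial>lborel)" if "x \<noteq> 0" for x :: 'a
  proof -
    have "(\<integral>\<^sup>+r. h r * ennreal (1 / r) * indicator {norm x..} r \<partial>lborel) =
       (\<integral>\<^sup>+t. ennreal (norm x) *
         (h (0 + norm x * t) * ennreal (1 / (0 + norm x * t)) * indicator {norm x..} (0 + norm x * t)) \<partial>lborel)"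
      using that by (subst nn_integral_real_affine[of _ "norm x" 0]) (auto simp: nn_integral_cmult)
    also have "\<dots> = (\<integral>\<^sup>+t. h (t * norm x) * ennreal (1 / t) * indicator {1..} t \<partial>lborel)"
    proof (rule nn_integral_cong)
      fix t :: real
      have "ennreal (norm x) * ennreal (1 / (norm x * t)) = ennreal (1 / t)" if "t \<ge> 1"
        using that \<open>x \<noteq> 0\<close> by (subst ennreal_mult[symmetric]) auto
      hence "ennreal (norm x) * (y * ennreal (1 / (norm x * t))) = y * ennreal (1 / t)"
        if "t \<ge> 1" for y
        using that by (simp add: mult.left_commute[of _ y])
      thus "ennreal (norm x) *
         (h (0 + norm x * t) * ennreal (1 / (0 + norm x * t)) * indicator {norm x..} (0 + norm x * t)) =
         h (t * norm x) * ennreal (1 / t) * indicator {1..} t"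
        using \<open>x \<noteq> 0\<close> by (auto split: split_indicator simp: mult.commute[of _ "norm x"])
    qed
    finally show ?thesis .
  qed
  \<comment> \<open>rescaling of \<open>x\<close> by \<open>t\<close>, which leaves \<open>sgn x\<close> unchanged\<close>
  have scaled: "(\<integral>\<^sup>+x. h (t * norm x) * F (sgn x) * indicator (- {0}) x \<partial>lborel) =
      ennreal (t powr (- ?d)) * I" if "t > 0" for t
  proof -
    have "I = ennreal (t ^ DIM('a)) *
        (\<integral>\<^sup>+x. h (t * norm x) * F (sgn x) * indicator (- {0}) x \<partial>lborel)"
      unfolding IG G_def using that
      by (subst nn_integral_lborel_scaleR[of _ t])
         (auto intro!: arg_cong2[where f="(*)"] nn_integral_cong simp: sgn_scaleR_pos split: split_indicator)
    moreover have "ennreal (t powr (- ?d)) * ennreal (t ^ DIM('a)) = 1"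
      using that by (subst ennreal_mult[symmetric]) (auto simp: powr_minus powr_realpow)
    ultimately show ?thesis by (simp add: mult.assoc[symmetric])
  qed
  have "(\<integral>\<^sup>+r. h r * ennreal (r powr (?d - 1)) * indicator {0<..} r \<partial>lborel) * B =
      (\<integral>\<^sup>+r. h r * indicator {0<..} r * (ennreal (r powr (?d - 1)) * B) \<partial>lborel)"
    by (subst nn_integral_multc[symmetric]) (auto simp: mult_ac)
  also have "\<dots> = (\<integral>\<^sup>+r. (\<integral>\<^sup>+x. h r * indicator {0<..} r * (ennreal (1 / r) *
      (F (sgn x) * indicator (cball 0 r - {0}) x)) \<partial>lborel) \<partial>lborel)"
  proof (rule nn_integral_cong)
    fix r :: real
    show "h r * indicator {0<..} r * (ennreal (r powr (?d - 1)) * B) =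
      (\<integral>\<^sup>+x. h r * indicator {0<..} r * (ennreal (1 / r) *
      (F (sgn x) * indicator (cball 0 r - {0}) x)) \<partial>lborel)"
      by (cases "r > 0") (auto simp: ball nn_integral_cmult)
  qed
  \<comment> \<open>The domain \<open>|x| \<le> r\<close> is written as \<open>0 \<le> r - |x|\<close>, which makes the integrand evidently jointly
      measurable.\<close>
  also have "\<dots> = (\<integral>\<^sup>+r. (\<integral>\<^sup>+x. F (sgn x) * indicator (- {0}) x *
      (h r * ennreal (1 / r) * indicator {0..} (r - norm x)) \<partial>lborel) \<partial>lborel)"
    by (intro nn_integral_cong) (auto split: split_indicator simp: mult_ac dest: pos)
  also have "\<dots> = (\<integral>\<^sup>+x. (\<integral>\<^sup>+r. F (sgn x) * indicator (- {0}) x *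
      (h r * ennreal (1 / r) * indicator {0..} (r - norm x)) \<partial>lborel) \<partial>lborel)"
    by (rule lborel_pair.Fubini') measurable
  also have "\<dots> = (\<integral>\<^sup>+x. F (sgn x) * indicator (- {0}) x *
      (\<integral>\<^sup>+r. h r * ennreal (1 / r) * indicator {norm x..} r \<partial>lborel) \<partial>lborel)"
    by (subst nn_integral_cmult[symmetric])
       (auto intro!: nn_integral_cong split: split_indicator)
  also have "\<dots> = (\<integral>\<^sup>+x. F (sgn x) * indicator (- {0}) x *
      (\<integral>\<^sup>+t. h (t * norm x) * ennreal (1 / t) * indicator {1..} t \<partial>lborel) \<partial>lborel)"
    by (intro nn_integral_cong) (auto simp: radial split: split_indicator)
  also have "\<dots> = (\<integral>\<^sup>+x. (\<integral>\<^sup>+t. F (sgn x) * indicator (- {0}) x *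
      (h (t * norm x) * ennreal (1 / t) * indicator {1..} t) \<partial>lborel) \<partial>lborel)"
    by (subst nn_integral_cmult) auto
  also have "\<dots> = (\<integral>\<^sup>+t. (\<integral>\<^sup>+x. F (sgn x) * indicator (- {0}) x *
      (h (t * norm x) * ennreal (1 / t) * indicator {1..} t) \<partial>lborel) \<partial>lborel)"
    by (rule lborel_pair.Fubini') measurable
  also have "\<dots> = (\<integral>\<^sup>+t. ennreal (1 / t) * indicator {1..} t *
      (\<integral>\<^sup>+x. h (t * norm x) * F (sgn x) * indicator (- {0}) x \<partial>lborel) \<partial>lborel)"
    by (subst nn_integral_cmult[symmetric]) (auto simp: mult_ac)
  also have "\<dots> = (\<integral>\<^sup>+t. ennreal (t powr (- ?d - 1)) * indicator {1..} t * I \<partial>lborel)"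
  proof (rule nn_integral_cong)
    fix t :: real
    have "ennreal (1 / t) * ennreal (t powr (- ?d)) = ennreal (t powr (- ?d - 1))" if "t \<ge> 1"
      using that by (subst ennreal_mult[symmetric]) (auto simp: powr_diff)
    thus "ennreal (1 / t) * indicator {1..} t *
      (\<integral>\<^sup>+x. h (t * norm x) * F (sgn x) * indicator (- {0}) x \<partial>lborel) =
      ennreal (t powr (- ?d - 1)) * indicator {1..} t * I"
      by (cases "t \<ge> 1") (auto simp: scaled mult.assoc[symmetric])
  qed
  also have "\<dots> = (\<integral>\<^sup>+t. ennreal (t powr (- ?d - 1)) * indicator {1..} t \<partial>lborel) * I"
    by (rule nn_integral_multc) auto
  also have "(\<integral>\<^sup>+t. ennreal (t powr (- ?d - 1)) * indicator {1..} t \<partial>lborel) = ennreal (1 / ?d)"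
    using nn_integral_has_integral_lebesgue'[OF _ has_integral_powr_to_inf[of "- ?d - 1" 1]]
    by simp
  finally have "(\<integral>\<^sup>+r. h r * ennreal (r powr (?d - 1)) * indicator {0<..} r \<partial>lborel) * B =
      ennreal (1 / ?d) * I" .
  hence "(\<integral>\<^sup>+r. h r * ennreal (r powr (?d - 1)) * indicator {0<..} r \<partial>lborel) * (ennreal ?d * B) =
      (ennreal ?d * ennreal (1 / ?d)) * I"
    by (simp only: mult.left_commute[of _ "ennreal ?d"]) (simp only: mult.assoc)
  also have "ennreal ?d * ennreal (1 / ?d) = 1"
    by (subst ennreal_mult[symmetric]) auto
  finally show ?thesis
    by (simp add: I_def B_def nn_integral_surface_measure)
qed

section \<open>Gaussian moments of homogeneous functions\<close>

text \<open>
  Reading \<open>exp (- r\<^sup>2 / 2)\<close> as the probability that an exponential variable \<open>V\<close> exceeds \<open>r\<^sup>2 / 2\<close> and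
  integrating over \<open>r\<close> first reduces the claim to the moment of \<open>V\<close> of order \<open>q / 2\<close>.
\<close>

lemma nn_integral_powr_exp_half_square:
  assumes "q > 0"
  shows "(\<integral>\<^sup>+r. ennreal (r powr (q - 1) * exp (- r\<^sup>2 / 2)) * indicator {0<..} r \<partial>lborel) =
    ennreal (2 powr (q / 2 - 1) * Gamma (q / 2))"
proof -
  interpret E: prob_space std_exponential by (rule prob_space_std_exponential)
  interpret LE: pair_sigma_finite "lborel :: real measure" std_exponential ..
  have tail: "(\<integral>\<^sup>+v. indicator {0<..} (v - r\<^sup>2 / 2) \<partial>std_exponential) = ennreal (exp (- r\<^sup>2 / 2))" for r
  proof -
    have "(\<integral>\<^sup>+v. indicator {0<..} (v - r\<^sup>2 / 2) \<partial>std_exponential) =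
        (\<integral>\<^sup>+v. indicator {r\<^sup>2 / 2<..} v \<partial>std_exponential)"
      by (intro nn_integral_cong) (auto split: split_indicator)
    thus ?thesis by (simp add: emeasure_std_exponential_greaterThan)
  qed
  have inner: "(\<integral>\<^sup>+r. ennreal (r powr (q - 1)) * indicator {0<..} r * indicator {0<..} (v - r\<^sup>2 / 2) \<partial>lborel) =
      ennreal (2 powr (q / 2) / q) * ennreal (v powr (q / 2))" if "v > 0" for v :: real
  proof -
    have lt: "v - r\<^sup>2 / 2 > 0 \<longleftrightarrow> r < sqrt (2 * v)" if "r > 0" for r
      using that real_less_rsqrt[of r "2 * v"] real_sqrt_less_iff[of "r\<^sup>2" "2 * v"] by auto
    have "(\<integral>\<^sup>+r. ennreal (r powr (q - 1)) * indicator {0<..} r * indicator {0<..} (v - r\<^sup>2 / 2) \<partial>lborel) =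
       (\<integral>\<^sup>+r. ennreal (r powr (q - 1)) * indicator {0..sqrt (2 * v)} r \<partial>lborel)"
      using AE_lborel_singleton[of "sqrt (2 * v)"] AE_lborel_singleton[of 0]
      by (intro nn_integral_cong_AE, eventually_elim) (use lt in \<open>auto split: split_indicator\<close>)
    also have "\<dots> = ennreal (sqrt (2 * v) powr q / q)"
      using nn_integral_has_integral_lebesgue'[OF _ has_integral_powr_from_0[of "q - 1" "sqrt (2 * v)"]]
        assms that by simp
    also have "sqrt (2 * v) powr q / q = 2 powr (q / 2) / q * v powr (q / 2)"
      using that by (simp add: powr_half_sqrt[symmetric] powr_powr powr_mult)
    finally show ?thesis
      using assms by (subst ennreal_mult[symmetric]) auto
  qed
  have "(\<integral>\<^sup>+r. ennreal (r powr (q - 1) * exp (- r\<^sup>2 / 2)) * indicator {0<..} r \<partial>lborel) =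
     (\<integral>\<^sup>+r. (\<integral>\<^sup>+v. ennreal (r powr (q - 1)) * indicator {0<..} r *
        indicator {0<..} (v - r\<^sup>2 / 2) \<partial>std_exponential) \<partial>lborel)"
    by (simp add: nn_integral_cmult tail ennreal_mult mult_ac)
  also have "\<dots> = (\<integral>\<^sup>+v. (\<integral>\<^sup>+r. ennreal (r powr (q - 1)) * indicator {0<..} r *
        indicator {0<..} (v - r\<^sup>2 / 2) \<partial>lborel) \<partial>std_exponential)"
    by (rule LE.Fubini'[symmetric]) measurable
  also have "\<dots> = (\<integral>\<^sup>+v. ennreal (2 powr (q / 2) / q) * ennreal (v powr (q / 2)) \<partial>std_exponential)"
    using AE_std_exponential_pos
    by (intro nn_integral_cong_AE, eventually_elim) (rule inner)
  also have "\<dots> = ennreal (2 powr (q / 2) / q) * ennreal (Gamma (q / 2 + 1))"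
    using assms by (subst nn_integral_cmult) (simp_all add: nn_integral_std_exponential_powr)
  also have "\<dots> = ennreal (2 powr (q / 2) / q * Gamma (q / 2 + 1))"
    using assms by (intro ennreal_mult[symmetric] Gamma_real_nonneg) auto
  also have "2 powr (q / 2) / q * Gamma (q / 2 + 1) = 2 powr (q / 2 - 1) * Gamma (q / 2)"
  proof -
    have "q / 2 \<notin> \<int>\<^sub>\<le>\<^sub>0"
      using assms nonpos_Ints_nonpos[of "q / 2"] by auto
    hence G: "Gamma (q / 2 + 1) = q / 2 * Gamma (q / 2)" by (rule Gamma_plus1)
    show ?thesis unfolding G using assms by (simp add: powr_diff)
  qed
  finally show ?thesis .
qed

text \<open>
  For \<open>x \<noteq> 0\<close> homogeneity gives \<open>N x = norm x * N (sgn x)\<close>, so the integrand is a function of the norm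
  times a function of the direction and polar coordinates apply.
\<close>

lemma std_gaussian_moment_homogeneous:
  fixes N :: "'a::euclidean_space \<Rightarrow> real"
  assumes [measurable]: "N \<in> borel_measurable borel" and nonneg: "\<And>x. N x \<ge> 0"
    and homogeneous: "\<And>t x. t > 0 \<Longrightarrow> N (t *\<^sub>R x) = t * N x"
    and p: "p > - real DIM('a)"
  shows "(\<integral>\<^sup>+x. epowr (N x) p \<partial>std_gaussian) =
    ennreal (2 powr (p / 2 - 1) / pi powr (real DIM('a) / 2) * Gamma ((real DIM('a) + p) / 2)) *
    (\<integral>\<^sup>+u. epowr (N u) p \<partial>surface_measure)"
proof -
  let ?d = "real DIM('a)" and ?c = "(2 * pi) powr (- (real DIM('a) / 2))"
  have "(\<integral>\<^sup>+x. epowr (N x) p \<partial>std_gaussian) =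
      (\<integral>\<^sup>+x. ennreal (?c * exp (- (norm x)\<^sup>2 / 2)) * epowr (N x) p \<partial>lborel)"
    unfolding std_gaussian_def std_gaussian_density
    by (rule nn_integral_density) auto
  also have "\<dots> = (\<integral>\<^sup>+x. ennreal ?c *
      (ennreal (norm x powr p * exp (- (norm x)\<^sup>2 / 2)) * epowr (N (sgn x)) p) \<partial>lborel)"
  proof (intro nn_integral_cong_AE)
    show "AE x in lborel. ennreal (?c * exp (- (norm x)\<^sup>2 / 2)) * epowr (N x) p =
      ennreal ?c * (ennreal (norm x powr p * exp (- (norm x)\<^sup>2 / 2)) * epowr (N (sgn x)) p)"
      using AE_lborel_singleton[of 0]
    proof eventually_elim
      fix x :: 'a assume "x \<noteq> 0"
      hence "N x = N (sgn x) * norm x"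
        using homogeneous[of "norm x" "sgn x"] by (simp add: sgn_div_norm mult.commute)
      hence "epowr (N x) p = epowr (N (sgn x)) p * ennreal (norm x powr p)"
        using \<open>x \<noteq> 0\<close> nonneg by (simp add: epowr_mult)
      thus "ennreal (?c * exp (- (norm x)\<^sup>2 / 2)) * epowr (N x) p =
        ennreal ?c * (ennreal (norm x powr p * exp (- (norm x)\<^sup>2 / 2)) * epowr (N (sgn x)) p)"
        by (simp add: ennreal_mult mult_ac)
    qed
  qed
  also have "\<dots> = ennreal ?c *
      (\<integral>\<^sup>+x. ennreal (norm x powr p * exp (- (norm x)\<^sup>2 / 2)) * epowr (N (sgn x)) p \<partial>lborel)"
    by (rule nn_integral_cmult) auto
  also have "\<dots> = ennreal ?c *
      ((\<integral>\<^sup>+r. ennreal (r powr p * exp (- r\<^sup>2 / 2)) * ennreal (r powr (?d - 1)) * indicator {0<..} r \<partial>lborel) *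
       (\<integral>\<^sup>+u. epowr (N u) p \<partial>surface_measure))"
    by (subst nn_integral_polar) auto
  also have "(\<integral>\<^sup>+r. ennreal (r powr p * exp (- r\<^sup>2 / 2)) * ennreal (r powr (?d - 1)) * indicator {0<..} r \<partial>lborel) =
     (\<integral>\<^sup>+r. ennreal (r powr ((?d + p) - 1) * exp (- r\<^sup>2 / 2)) * indicator {0<..} r \<partial>lborel)"
    by (intro nn_integral_cong)
       (auto simp: ennreal_mult[symmetric] powr_add[symmetric] algebra_simps split: split_indicator)
  also have "\<dots> = ennreal (2 powr ((?d + p) / 2 - 1) * Gamma ((?d + p) / 2))"
    using p by (intro nn_integral_powr_exp_half_square) simp
  also have "ennreal ?c * (ennreal (2 powr ((?d + p) / 2 - 1) * Gamma ((?d + p) / 2)) *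
       (\<integral>\<^sup>+u. epowr (N u) p \<partial>surface_measure)) =
     ennreal (?c * (2 powr ((?d + p) / 2 - 1) * Gamma ((?d + p) / 2))) *
       (\<integral>\<^sup>+u. epowr (N u) p \<partial>surface_measure)"
    by (simp add: ennreal_mult' mult.assoc)
  also have "?c * (2 powr ((?d + p) / 2 - 1) * Gamma ((?d + p) / 2)) =
      2 powr (p / 2 - 1) / pi powr (?d / 2) * Gamma ((?d + p) / 2)"
  proof -
    have "?c = 2 powr (- (?d / 2)) / pi powr (?d / 2)"
      by (simp add: powr_mult powr_minus_divide)
    moreover have "2 powr (- (?d / 2)) * 2 powr ((?d + p) / 2 - 1) = (2 powr (p / 2 - 1) :: real)"
      by (simp add: add_divide_distrib flip: powr_add)
    ultimately show ?thesis by simp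
  qed
  finally show ?thesis .
qed

section \<open>The star norm and the moments of a stable vector\<close>

lemma star_norm_nonneg: "star_norm \<alpha> \<sigma> u \<ge> 0"
  by (simp add: star_norm_def)

lemma star_norm_powr:
  assumes "\<alpha> > 0"
  shows "star_norm \<alpha> \<sigma> u powr \<alpha> = (LINT z|\<sigma>. \<bar>u \<bullet> z\<bar> powr \<alpha>)"
  using assms by (simp add: star_norm_def powr_powr)

lemma borel_measurable_star_norm:
  fixes \<sigma> :: "'a::euclidean_space measure"
  assumes "finite_measure \<sigma>" and "sets \<sigma> = sets (restrict_space borel (sphere 0 1))"
  shows "star_norm \<alpha> \<sigma> \<in> borel_measurable borel"
proof -
  interpret finite_measure \<sigma> by fact
  have [measurable]: "(\<lambda>z. z) \<in> \<sigma> \<rightarrow>\<^sub>M borel"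
    unfolding measurable_cong_sets[OF assms(2) refl]
    by (rule measurable_restrict_space1) measurable
  show ?thesis
    unfolding star_norm_def by measurable
qed

text \<open>
  This is \<open>char_duality\<close> for the vector \<open>\<xi> / s\<close>, whose characteristic function at \<open>x\<close> is that of \<open>\<xi>\<close> at
  \<open>x / s\<close>. The divisor \<open>sqrt 2\<close> absorbs the factor \<open>1 / 2\<close> in the Gaussian characteristic function, so
  that the left-hand side has the form required by \<open>moments_from_exponential_transforms\<close> with exponent 2.
\<close>

lemma exponential_transform_duality:
  fixes \<xi> :: "'w \<Rightarrow> 'a::euclidean_space"
  assumes \<alpha>: "\<alpha> > 0" and M: "prob_space M" and [measurable]: "\<xi> \<in> borel_measurable M"
    and \<sigma>: "spectral_measure \<alpha> M \<xi> \<sigma>" and s: "s > 0"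
  shows "(\<integral>\<^sup>+\<omega>. ennreal (exp (- ((norm (\<xi> \<omega>) / sqrt 2 / s) powr 2))) \<partial>M) =
         (\<integral>\<^sup>+x. ennreal (exp (- ((star_norm \<alpha> \<sigma> x / s) powr \<alpha>))) \<partial>std_gaussian)"
proof -
  interpret M: prob_space M by fact
  interpret N: prob_space "std_gaussian :: 'a measure" by (rule prob_space_std_gaussian)
  have [measurable]: "star_norm \<alpha> \<sigma> \<in> borel_measurable borel"
    using \<sigma> by (intro borel_measurable_star_norm) (auto simp: spectral_measure_def)
  let ?f = "\<lambda>\<omega>. exp (- ((norm (\<xi> \<omega>) / sqrt 2 / s) powr 2))"
  let ?g = "\<lambda>x. exp (- ((star_norm \<alpha> \<sigma> x / s) powr \<alpha>))"
  have "complex_of_real (LINT \<omega>|M. ?f \<omega>) =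
      (CLINT \<omega>|M. complex_of_real (exp (- (norm ((1 / s) *\<^sub>R \<xi> \<omega>))\<^sup>2 / 2)))"
    using s by (simp add: power_divide field_simps del: of_real_exp flip: integral_complex_of_real)
  also have "\<dots> = (CLINT x|std_gaussian. CLINT \<omega>|M. iexp (((1 / s) *\<^sub>R \<xi> \<omega>) \<bullet> x))"
    by (rule char_duality) (use M in auto)
  also have "\<dots> = (CLINT x|std_gaussian. complex_of_real (?g x))"
  proof (rule Bochner_Integration.integral_cong)
    fix x :: 'a
    have "(CLINT \<omega>|M. iexp (((1 / s) *\<^sub>R \<xi> \<omega>) \<bullet> x)) = (CLINT \<omega>|M. iexp (\<xi> \<omega> \<bullet> ((1 / s) *\<^sub>R x)))"
      by simp
    also have "\<dots> = complex_of_real (exp (- (LINT z|\<sigma>. \<bar>((1 / s) *\<^sub>R x) \<bullet> z\<bar> powr \<alpha>)))"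
      using \<sigma> unfolding spectral_measure_def by blast
    also have "\<dots> = complex_of_real (exp (- (star_norm \<alpha> \<sigma> ((1 / s) *\<^sub>R x) powr \<alpha>)))"
      by (simp only: star_norm_powr[OF \<alpha>])
    also have "\<dots> = complex_of_real (?g x)"
      using s \<alpha> by (subst star_norm_scaleR) auto
    finally show "(CLINT \<omega>|M. iexp (((1 / s) *\<^sub>R \<xi> \<omega>) \<bullet> x)) = complex_of_real (?g x)" .
  qed simp
  also have "\<dots> = complex_of_real (LINT x|std_gaussian. ?g x)"
    by (rule integral_complex_of_real)
  finally have eq: "(LINT \<omega>|M. ?f \<omega>) = (LINT x|std_gaussian. ?g x)"
    by (simp only: of_real_eq_iff)
  have "(\<integral>\<^sup>+\<omega>. ennreal (?f \<omega>) \<partial>M) = ennreal (LINT \<omega>|M. ?f \<omega>)"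
    by (intro nn_integral_eq_integral M.integrable_const_bound[where B = 1]) auto
  moreover have "(\<integral>\<^sup>+x. ennreal (?g x) \<partial>std_gaussian) = ennreal (LINT x|std_gaussian. ?g x)"
    by (intro nn_integral_eq_integral N.integrable_const_bound[where B = 1]) auto
  ultimately show ?thesis by (simp only: eq)
qed

theorem theorem6p1:
  fixes \<alpha> p :: real
    and M :: "'w measure"
    and \<xi> :: "'w \<Rightarrow> 'a::euclidean_space"
    and \<sigma> :: "'a measure"
    and F :: "'a set"
  assumes "0 < \<alpha>" and "\<alpha> \<le> 2"
    and "prob_space M" and "\<xi> \<in> borel_measurable M"
    and "symmetric_stable \<alpha> M \<xi>"
    and "spectral_measure \<alpha> M \<xi> \<sigma>"
    and "F = star_body \<alpha> \<sigma>"
    and "- real DIM('a) < p" and "p < \<alpha>"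
  shows "(\<integral>\<^sup>+\<omega>. epowr (norm (\<xi> \<omega>)) p \<partial>M) =
    ennreal (2 powr (p - 1) / pi powr (real DIM('a) / 2) * Gamma ((real DIM('a) + p) / 2)
             * (Gamma (1 - p / \<alpha>) / Gamma (1 - p / 2)))
    * (\<integral>\<^sup>+u. epowr (minkowski_functional F u) p \<partial>surface_measure)"
proof -
  let ?L = "\<integral>\<^sup>+\<omega>. epowr (norm (\<xi> \<omega>)) p \<partial>M"
  let ?R = "\<integral>\<^sup>+u. epowr (star_norm \<alpha> \<sigma> u) p \<partial>surface_measure"
  let ?k = "2 powr (- (p / 2)) * Gamma (1 - p / 2)"
  let ?m = "2 powr (p / 2 - 1) / pi powr (real DIM('a) / 2) * Gamma ((real DIM('a) + p) / 2)"
  note [measurable] = \<open>\<xi> \<in> borel_measurable M\<close>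
  have [measurable]: "star_norm \<alpha> \<sigma> \<in> borel_measurable borel"
    using assms by (intro borel_measurable_star_norm) (auto simp: spectral_measure_def)
  have Gpos: "Gamma (1 - p / 2) > 0" "Gamma (1 - p / \<alpha>) > 0"
    using assms by (auto intro!: Gamma_real_pos)
  have "(\<integral>\<^sup>+\<omega>. epowr (norm (\<xi> \<omega>) / sqrt 2) p \<partial>M) * ennreal (Gamma (1 - p / 2)) =
        (\<integral>\<^sup>+x. epowr (star_norm \<alpha> \<sigma> x) p \<partial>std_gaussian) * ennreal (Gamma (1 - p / \<alpha>))"
    using assms prob_space_std_gaussian
    by (intro moments_from_exponential_transforms exponential_transform_duality)
       (auto simp: star_norm_nonneg)
  moreover have "(\<integral>\<^sup>+\<omega>. epowr (norm (\<xi> \<omega>) / sqrt 2) p \<partial>M) = ?L * ennreal (2 powr (- (p / 2)))"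
  proof -
    have "sqrt 2 powr (- p) = 2 powr (- (p / 2))"
      by (subst powr_half_sqrt[symmetric]) (auto simp: powr_powr)
    thus ?thesis by (simp add: epowr_divide nn_integral_multc)
  qed
  moreover have "(\<integral>\<^sup>+x. epowr (star_norm \<alpha> \<sigma> x) p \<partial>std_gaussian) = ennreal ?m * ?R"
    using assms by (intro std_gaussian_moment_homogeneous) (auto simp: star_norm_nonneg star_norm_scaleR)
  moreover have "ennreal ?k = ennreal (2 powr (- (p / 2))) * ennreal (Gamma (1 - p / 2))"
    using Gpos by (intro ennreal_mult) auto
  ultimately have eq: "?L * ennreal ?k = ennreal ?m * ennreal (Gamma (1 - p / \<alpha>)) * ?R"
    by (simp only: mult_ac)
  have "ennreal ?k * ennreal (1 / ?k) = 1"
    using Gpos by (subst ennreal_mult[symmetric]) auto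
  hence "?L = ?L * ennreal ?k * ennreal (1 / ?k)"
    by (simp only: mult.assoc mult_1_right)
  also have "\<dots> = ennreal ?m * ennreal (Gamma (1 - p / \<alpha>)) * ennreal (1 / ?k) * ?R"
    unfolding eq by (simp only: mult_ac)
  also have "ennreal ?m * ennreal (Gamma (1 - p / \<alpha>)) * ennreal (1 / ?k) =
      ennreal (?m * Gamma (1 - p / \<alpha>) * (1 / ?k))"
    using Gpos by (simp flip: ennreal_mult'')
  also have "?m * Gamma (1 - p / \<alpha>) * (1 / ?k) =
     2 powr (p - 1) / pi powr (real DIM('a) / 2) * Gamma ((real DIM('a) + p) / 2)
             * (Gamma (1 - p / \<alpha>) / Gamma (1 - p / 2))"
  proof -
    have "2 powr (p - 1) = 2 powr (p / 2 - 1) / 2 powr (- (p / 2))"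
      by (simp flip: powr_diff)
    thus ?thesis by simp
  qed
  finally show ?thesis
    using assms by (simp only: minkowski_functional_star_body)
qed

end
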